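(* Let $\mathbf I=\mathrm{diag}(I_1,I_2,I_2)$ with $I_1\ne I_2$, $0<I_i<\tfrac12$ and $I_1+2I_2=1$. Let $((\mathrm{Id},\mathbf R),(\xi,\eta))$ be a relative equilibrium of the axisymmetric second order model with $\mathbf R\cdot\xi\neq0$. Then, up to translation by elements of $G^{\mathrm{axi}}$, there are two possibilities. (Conical) There exist $R>0$ and $\psi\in S^1$, $\psi\ne0,\pm\frac\pi2,\pi$, such that $$\mathbf R=R(\cos\psi,\sin\psi,0),\qquad \xi=(\xi_1,\lambda R\sin\psi,0),$$ where $\xi_1=\dfrac{3\cos\psi}{\lambda R^4}+\dfrac{I_1}{I_1-I_2}\eta$ and $$\eta=\frac{\cos\psi\,(I_1-I_2)}{2\sin^2\psi\,\lambda I_1R^6}\Big((15\cos^2\psi-9)(I_1-I_2)-8R^2+6R^2\cos^2\psi+2\lambda^2R^7\sin^2\psi\Big),$$ $$\lambda^2=\frac{\cos^2\psi\,\big(2R^2+(9-15\cos^2\psi)(I_1-I_2)\big)^2}{2R^7\sin^2\psi\,\big(2R^2+(3-9\cos^2\psi)(I_1-I_2)\big)} .$$ (Parallel) $\mathbf R$ is an eigenvector of $\mathbf I$ satisfying $1+\dfrac{3}{2R^2}\Big(1-3\,\dfrac{\mathbf R\cdot\mathbf I\mathbf R}{R^2}\Big)=0$ with $R=|\mathbf R|$, the spinning speed vanishes ($\eta=0$), and $\xi$ is an arbitrary multiple of $\mathbf R$.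
   Context: Axisymmetric second order satellite model. Units are chosen so that the satellite has mass $1$ and its inertia tensor $\mathbf I=\mathrm{diag}(I_1,I_2,I_2)$ has trace $1$; the first body axis $\mathbf e_1$ is the symmetry axis. The configuration space is $Q=SO(3)\times\mathbb R^3$ with points $(B,\mathbf R)$ in body coordinates (the potential below being defined for $\mathbf R\neq0$). Tangent vectors are written $(\Omega,\dot{\mathbf R})\in\mathbb R^3\times\mathbb R^3$ with $\dot B=B\widehat\Omega$, where $\widehat\Omega u=\Omega\times u$. The kinetic energy is $K=\frac12(\Omega\cdot\mathbf I\Omega+|\dot{\mathbf R}+\Omega\times\mathbf R|^2)$, the potential is $$V_2(\mathbf R)=-\frac1R-\frac1{2R^3}+\frac{3}{2R^5}\,\mathbf R\cdot\mathbf I\mathbf R,\qquad R=|\mathbf R|,$$ and the system on $T^*Q$ has Hamiltonian $H_2=K+V_2$. Symmetry. Let $\Gamma^{\mathrm{axi}}\subset O(3)$ be the group of block matrices $\mathrm{diag}(s,O)$ with $s\in\{1,-1\}$, $O\in O(2)$, let $\chi(\mathrm{diag}(s,O))=\det O$, and let $G^{\mathrm{axi}}=SO(3)\times\Gamma^{\mathrm{axi}}$ act on $Q$ by $(M,N)\cdot(B,\mathbf R)=(MBN^T\det N,\,N\mathbf R)$. Its Lie algebra is identified with $\mathbb R^3\oplus\mathbb R$, where $(\xi,\eta)$ generates $(\exp(t\widehat\xi),\exp(t\eta\,\widehat{\mathbf e_1}))$; the adjoint action is $(M,N)\cdot(\xi,\eta)=(M\xi,\chi(N)\eta)$. Translating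 a pair $(q,(\xi,\eta))$ by $g\in G^{\mathrm{axi}}$ gives $(g\cdot q,\mathrm{Ad}_g(\xi,\eta))$. A relative equilibrium with velocity $(\xi,\eta)$ is a phase space point whose evolution is the orbit of the one-parameter subgroup generated by $(\xi,\eta)$; it is encoded by a pair $((B,\mathbf R),(\xi,\eta))$ such that $(B,\mathbf R)$ is a critical point of $V_{(\xi,\eta)}=V_2-\frac12\lVert(\xi,\eta)_Q\rVert^2$, where $(\xi,\eta)_Q(B,\mathbf R)=(B^T\xi-\eta\mathbf e_1,\ \eta\,\mathbf e_1\times\mathbf R)$ is the infinitesimal generator and the norm is that of the metric $2K$. For $B=\mathrm{Id}$ this is equivalent to $$\xi\times\big((\mathbf I-\widehat{\mathbf R}\widehat{\mathbf R})\xi-I_1\eta\,\mathbf e_1\big)=0,\qquad \nabla_{\mathbf R}V_2(\mathbf R)+\xi(\mathbf R\cdot\xi)-\mathbf R|\xi|^2=0 .$$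
   Formalization: In the parallel case with R on the symmetry axis, η is arbitrary, so η=0 fails literally; there the formal statement claims η=0 and ξ a multiple of R for a velocity generating the same tangent vector, namely (ξ−ηe₁, 0). *)

theory Defs
  imports "HOL-Analysis.Analysis"
begin

unbundle cross3_syntax

type_synonym config = "(real^3^3) \<times> (real^3)"
type_synonym velocity = "(real^3) \<times> real"

abbreviation e1 :: "real^3" where "e1 \<equiv> axis 1 1"

definition inertia :: "real \<Rightarrow> real \<Rightarrow> real^3^3" where
  "inertia I1 I2 = (\<chi> i j. if i = j then (if i = 1 then I1 else I2) else 0)"

definition Q_space :: "config set" where
  "Q_space = {(B, R). rotation_matrix B}"

text \<open>A tangent vector at \<open>(B, R)\<close> is a pair \<open>(\<Omega>, R')\<close> in body coordinates, standing for
  \<open>dB/dt = B \<Omega>^\<close>, \<open>dR/dt = R'\<close>.\<close>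

definition kinetic :: "real \<Rightarrow> real \<Rightarrow> config \<Rightarrow> (real^3) \<times> (real^3) \<Rightarrow> real" where
  "kinetic I1 I2 q v = (case (q, v) of ((B, R), (\<Omega>, R')) \<Rightarrow>
     1/2 * (\<Omega> \<bullet> (inertia I1 I2 *v \<Omega>) + (norm (R' + \<Omega> \<times> R))\<^sup>2))"

definition V2 :: "real \<Rightarrow> real \<Rightarrow> real^3 \<Rightarrow> real" where
  "V2 I1 I2 R = - 1 / norm R - 1 / (2 * norm R ^ 3)
     + 3 / (2 * norm R ^ 5) * (R \<bullet> (inertia I1 I2 *v R))"

definition diag_block :: "real \<Rightarrow> real^2^2 \<Rightarrow> real^3^3" where
  "diag_block s A = vector [vector [s, 0, 0],
                            vector [0, A$1$1, A$1$2],
                            vector [0, A$2$1, A$2$2]]"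

definition Gamma_axi :: "(real^3^3) set" where
  "Gamma_axi = {diag_block s A | s A. s \<in> {1, -1} \<and> orthogonal_matrix A}"

definition lower_block :: "real^3^3 \<Rightarrow> real^2^2" where
  "lower_block N = vector [vector [N$2$2, N$2$3], vector [N$3$2, N$3$3]]"

definition chi :: "real^3^3 \<Rightarrow> real" where
  "chi N = det (lower_block N)"

definition G_axi :: "((real^3^3) \<times> (real^3^3)) set" where
  "G_axi = {(M, N). rotation_matrix M \<and> N \<in> Gamma_axi}"

definition act :: "(real^3^3) \<times> (real^3^3) \<Rightarrow> config \<Rightarrow> config" where
  "act g q = (case (g, q) of ((M, N), (B, R)) \<Rightarrow>
     (det N *\<^sub>R (M ** B ** transpose N), N *v R))"

definition Ad :: "(real^3^3) \<times> (real^3^3) \<Rightarrow> velocity \<Rightarrow> velocity" where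
  "Ad g v = (case (g, v) of ((M, N), (\<xi>, \<eta>)) \<Rightarrow> (M *v \<xi>, chi N * \<eta>))"

definition translate ::
    "(real^3^3) \<times> (real^3^3) \<Rightarrow> config \<times> velocity \<Rightarrow> config \<times> velocity" where
  "translate g p = (act g (fst p), Ad g (snd p))"

definition inf_gen :: "velocity \<Rightarrow> config \<Rightarrow> (real^3) \<times> (real^3)" where
  "inf_gen v q = (case (v, q) of ((\<xi>, \<eta>), (B, R)) \<Rightarrow>
     (transpose B *v \<xi> - \<eta> *\<^sub>R e1, \<eta> *\<^sub>R (e1 \<times> R)))"

text \<open>The squared norm of a tangent vector in the metric \<open>2K\<close> is \<open>2 * kinetic\<close>.\<close>

definition V_aug :: "real \<Rightarrow> real \<Rightarrow> velocity \<Rightarrow> config \<Rightarrow> real" where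
  "V_aug I1 I2 v q = V2 I1 I2 (snd q) - 1/2 * (2 * kinetic I1 I2 q (inf_gen v q))"

text \<open>Critical point of (the restriction of) \<open>f\<close> on an embedded submanifold \<open>S\<close>: the derivative
  of \<open>f\<close> vanishes along every curve in \<open>S\<close> through the point.\<close>

definition critical_point_on ::
    "'a::real_normed_vector set \<Rightarrow> ('a \<Rightarrow> real) \<Rightarrow> 'a \<Rightarrow> bool" where
  "critical_point_on S f q \<longleftrightarrow> q \<in> S \<and>
     (\<forall>c :: real \<Rightarrow> 'a. (\<forall>t. c t \<in> S) \<and> c 0 = q \<and> c differentiable (at 0)
        \<longrightarrow> ((\<lambda>t. f (c t)) has_real_derivative 0) (at 0))"

definition rel_equilibrium :: "real \<Rightarrow> real \<Rightarrow> config \<times> velocity \<Rightarrow> bool" where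
  "rel_equilibrium I1 I2 p \<longleftrightarrow>
     snd (fst p) \<noteq> 0 \<and> critical_point_on Q_space (V_aug I1 I2 (snd p)) (fst p)"

text \<open>Two pairs encode the same phase space point if they have the same configuration \<open>q\<close> and their
  velocities generate the same tangent vector at \<open>q\<close> (equivalently, the same momentum). At
  \<open>(Id, R)\<close> the two velocities can differ only if \<open>R\<close> lies on the symmetry axis, where
  \<open>(\<xi>, \<eta>)\<close> and \<open>(\<xi> + a e1, \<eta> + a)\<close> generate the same tangent vector.\<close>

definition same_state :: "config \<times> velocity \<Rightarrow> config \<times> velocity \<Rightarrow> bool" where
  "same_state p p' \<longleftrightarrow>
     fst p = fst p' \<and> inf_gen (snd p) (fst p) = inf_gen (snd p') (fst p')"

text \<open>\<open>l \<noteq> 0\<close> is implicit in the formulas, which divide by \<open>l\<close>; with the formula for \<open>l\<^sup>2\<close> it also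
  forces the denominator of the latter to be nonzero. The circle is represented by
  \<open>{-pi<..pi}\<close>.\<close>

definition conical :: "real \<Rightarrow> real \<Rightarrow> real^3 \<Rightarrow> real^3 \<Rightarrow> real \<Rightarrow> bool" where
  "conical I1 I2 R \<xi> \<eta> \<longleftrightarrow>
     (\<exists>r \<psi> l \<xi>1.
        r > 0 \<and> \<psi> \<in> {-pi<..pi} - {0, pi/2, -pi/2, pi} \<and> l \<noteq> 0 \<and>
        R = r *\<^sub>R vector [cos \<psi>, sin \<psi>, 0] \<and>
        \<xi> = vector [\<xi>1, l * r * sin \<psi>, 0] \<and>
        \<xi>1 = 3 * cos \<psi> / (l * r^4) + I1 / (I1 - I2) * \<eta> \<and>
        \<eta> = cos \<psi> * (I1 - I2) / (2 * (sin \<psi>)\<^sup>2 * l * I1 * r^6) *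
              ((15 * (cos \<psi>)\<^sup>2 - 9) * (I1 - I2) - 8 * r\<^sup>2 + 6 * r\<^sup>2 * (cos \<psi>)\<^sup>2
                + 2 * l\<^sup>2 * r^7 * (sin \<psi>)\<^sup>2) \<and>
        l\<^sup>2 = (cos \<psi>)\<^sup>2 * (2 * r\<^sup>2 + (9 - 15 * (cos \<psi>)\<^sup>2) * (I1 - I2))\<^sup>2 /
              (2 * r^7 * (sin \<psi>)\<^sup>2 * (2 * r\<^sup>2 + (3 - 9 * (cos \<psi>)\<^sup>2) * (I1 - I2))))"

text \<open>The last conjunct expresses that the multiple is arbitrary: every multiple of \<open>R\<close> occurs.\<close>

definition parallel :: "real \<Rightarrow> real \<Rightarrow> real^3 \<Rightarrow> real^3 \<Rightarrow> real \<Rightarrow> bool" where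
  "parallel I1 I2 R \<xi> \<eta> \<longleftrightarrow>
     R \<noteq> 0 \<and> (\<exists>\<mu>. inertia I1 I2 *v R = \<mu> *\<^sub>R R) \<and>
     1 + 3 / (2 * (norm R)\<^sup>2) * (1 - 3 * ((R \<bullet> (inertia I1 I2 *v R)) / (norm R)\<^sup>2)) = 0 \<and>
     \<eta> = 0 \<and>
     (\<exists>c. \<xi> = c *\<^sub>R R) \<and>
     (\<forall>c. rel_equilibrium I1 I2 ((mat 1, R), (c *\<^sub>R R, 0)))"

end

theory Submission
  imports Defs
begin

text \<open>
  Along a curve \<open>(B, R)\<close> of configurations the augmented potential depends on \<open>B\<close> only through
  \<open>w = B\<^sup>T \<xi>\<close>, whose norm is constant. Curves with \<open>B\<close> constant give the gradient equation
  \<open>\<nabla>V\<^sub>2(R) + (R \<cdot> \<xi>) \<xi> - |\<xi>|\<^sup>2 R = 0\<close>, and rotations about the second and third axes give the two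
  components of the momentum equation that are needed. As \<open>\<nabla>V\<^sub>2(R)\<close> lies in the span of \<open>R\<close> and
  \<open>e1\<close>, so does \<open>\<xi>\<close>, and \<open>(\<xi>\<^sub>2, \<xi>\<^sub>3) = \<lambda> (R\<^sub>2, R\<^sub>3)\<close>. If \<open>R\<close> is orthogonal or parallel to the symmetry
  axis, then \<open>\<xi>\<close> is parallel to \<open>R\<close>, which gives the parallel family (for \<open>R\<close> on the axis after
  absorbing \<open>\<eta>\<close> into \<open>\<xi>\<close>, which does not change the state). Otherwise a rotation about the
  axis moves \<open>R\<close> and \<open>\<xi>\<close> into the plane of the first two coordinates, and eliminating \<open>\<xi>\<^sub>1\<close> between
  the two gradient components and the momentum equation yields the conical formulas.
\<close>

section \<open>Elimination for the conical family\<close>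

text \<open>Here \<open>x\<close> is the first component of the velocity, \<open>a\<close> the
  coefficient of R in the gradient of \<open>V2\<close>; \<open>B1\<close>, \<open>B2\<close> are
  the gradient equations and \<open>A\<close> the momentum equation. Although \<open>x\<close>
  enters quadratically, \<open>a\<close> and \<open>p\<close> factor so that two relations linear in
  \<open>x\<close> remain, \<open>E3'\<close> and \<open>E4\<close>. The latter gives
  \<open>\<eta>\<close>, both together give \<open>l\<^sup>2\<close>.\<close>

lemma conical_formulas:
  fixes c s r x l d I1 \<eta> a p :: real
  assumes cs: "c\<^sup>2 + s\<^sup>2 = 1" "c \<noteq> 0" "s \<noteq> 0" and r: "r > 0" and "d \<noteq> 0" "I1 > 0"
    and p: "p = r * (x * c + l * r * s\<^sup>2)" "p \<noteq> 0"
    and a: "a * (2 * r^5) = 2 * r\<^sup>2 + (3 - 15 * c\<^sup>2) * d"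
    and B1: "p * x = (x\<^sup>2 + l\<^sup>2 * r\<^sup>2 * s\<^sup>2 - a) * (r * c) - 3 * d * c / r^4"
    and B2: "p * l = x\<^sup>2 + l\<^sup>2 * r\<^sup>2 * s\<^sup>2 - a"
    and A: "l * (d * x - I1 * \<eta>) = p * (l * (r * c) - x)"
  shows "l \<noteq> 0"
    and "x = 3 * c / (l * r^4) + I1 / d * \<eta>"
    and "\<eta> = c * d / (2 * s\<^sup>2 * l * I1 * r^6) *
              ((15 * c\<^sup>2 - 9) * d - 8 * r\<^sup>2 + 6 * r\<^sup>2 * c\<^sup>2 + 2 * l\<^sup>2 * r^7 * s\<^sup>2)"
    and "l\<^sup>2 = c\<^sup>2 * (2 * r\<^sup>2 + (9 - 15 * c\<^sup>2) * d)\<^sup>2 /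
              (2 * r^7 * s\<^sup>2 * (2 * r\<^sup>2 + (3 - 9 * c\<^sup>2) * d))"
proof -
  \<comment> \<open>\<open>2 r\<^sup>5 a\<close>; the numerator of \<open>l\<^sup>2\<close> is \<open>c\<^sup>2 (D + 6 d)\<^sup>2\<close>, its denominator contains \<open>D + 6 d c\<^sup>2\<close>\<close>
  define D where "D = 2 * r\<^sup>2 + (3 - 15 * c\<^sup>2) * d"
  define q where "q = x * c + l * r * s\<^sup>2"
  have q: "p = r * q" "q \<noteq> 0" using p by (auto simp: q_def)
  \<comment> \<open>Subtracting \<open>r * c\<close> times \<open>B2\<close> from \<open>B1\<close>
    removes the squared norm and \<open>a\<close>. What remains is, up to sign, the right side of
    \<open>A\<close>.\<close>
  have "p * (x - l * r * c) = - 3 * d * c / r^4"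
    unfolding right_diff_distrib mult.assoc[symmetric] B1 B2 by (simp add: algebra_simps)
  then have E1: "p * (x - l * r * c) * r^4 = - 3 * d * c" using r by (simp add: field_simps)
  have "l * (d * x - I1 * \<eta>) * r^4 = - (p * (x - l * r * c) * r^4)"
    unfolding A by (simp add: algebra_simps)
  then have A': "l * (d * x - I1 * \<eta>) * r^4 = 3 * d * c" using E1 by simp
  then show l: "l \<noteq> 0" using assms by auto
  have "(d * x - I1 * \<eta>) * (l * r^4) = 3 * d * c" using A' by (simp add: algebra_simps)
  then have "d * x - I1 * \<eta> = 3 * d * c / (l * r^4)"
    using l r by (simp add: eq_divide_eq)
  moreover have "d * (3 * c / (l * r^4) + I1 / d * \<eta>) = 3 * d * c / (l * r^4) + I1 * \<eta>"
    using \<open>d \<noteq> 0\<close> by (simp add: distrib_left)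
  ultimately have "d * x = d * (3 * c / (l * r^4) + I1 / d * \<eta>)" by linarith
  then show x: "x = 3 * c / (l * r^4) + I1 / d * \<eta>" using \<open>d \<noteq> 0\<close> by simp
  \<comment> \<open>The terms \<open>l\<^sup>2 * r\<^sup>2 * s\<^sup>2\<close> cancel, so
    \<open>a\<close> contains the same factor \<open>x - l * r * c\<close> as
    \<open>E1\<close>.\<close>
  have E2: "a = x * (x - l * r * c)"
    using B2 unfolding p(1) by (simp add: algebra_simps power2_eq_square)
  have E1': "(x - l * r * c) * q * r^5 = - 3 * d * c"
    using E1 unfolding q by (simp add: eval_nat_numeral algebra_simps)
  have "D * q = 2 * x * ((x - l * r * c) * q * r^5)"
    unfolding D_def a[symmetric] E2 by (simp add: algebra_simps)
  then have E3: "D * q = - 6 * d * c * x" unfolding E1' by simp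
  then have E3': "x * c * (D + 6 * d) = - D * (l * r * s\<^sup>2)"
    unfolding q_def by (simp add: algebra_simps)
  have "(D + 6 * d) * q = 6 * d * (l * r * s\<^sup>2)"
    using E3 unfolding q_def by (simp add: algebra_simps)
  \<comment> \<open>Both sides equal \<open>- 6 * c * d * l * r * s\<^sup>2\<close>.\<close>
  then have "(2 * s\<^sup>2 * l * r^6 * (x - l * r * c)) * q = (- c * (D + 6 * d)) * q"
    using E1' by algebra
  then have E4: "2 * s\<^sup>2 * l * r^6 * (x - l * r * c) = - c * (D + 6 * d)"
    unfolding mult_right_cancel[OF q(2)] .
  have D6: "D + 6 * d \<noteq> 0"
    using E3' l r cs(3) \<open>d \<noteq> 0\<close> by auto
  have eta: "I1 * \<eta> * (l * r^4) = d * (x * (l * r^4) - 3 * c)"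
    using A' by (simp add: algebra_simps)
  have "\<eta> * (2 * s\<^sup>2 * l * I1 * r^6) = c * d *
      ((15 * c\<^sup>2 - 9) * d - 8 * r\<^sup>2 + 6 * r\<^sup>2 * c\<^sup>2 + 2 * l\<^sup>2 * r^7 * s\<^sup>2)"
    using eta E4 cs(1) unfolding D_def by algebra
  then show "\<eta> = c * d / (2 * s\<^sup>2 * l * I1 * r^6) *
      ((15 * c\<^sup>2 - 9) * d - 8 * r\<^sup>2 + 6 * r\<^sup>2 * c\<^sup>2 + 2 * l\<^sup>2 * r^7 * s\<^sup>2)"
    using l r cs \<open>I1 > 0\<close> by (simp add: eq_divide_eq)
  \<comment> \<open>Multiply \<open>E4\<close> by \<open>c * (D + 6 * d)\<close>, replace the
    product with \<open>x\<close> by \<open>E3'\<close>, and combine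
    \<open>D * s\<^sup>2 + (D + 6 * d) * c\<^sup>2\<close> into
    \<open>D + 6 * d * c\<^sup>2\<close>.\<close>
  have "2 * l\<^sup>2 * r^7 * s\<^sup>2 * (D + 6 * d * c\<^sup>2) = c\<^sup>2 * (D + 6 * d)\<^sup>2"
    using E4 E3' cs(1) by algebra
  then have E5: "l\<^sup>2 * (2 * r^7 * s\<^sup>2 * (2 * r\<^sup>2 + (3 - 9 * c\<^sup>2) * d)) =
      c\<^sup>2 * (2 * r\<^sup>2 + (9 - 15 * c\<^sup>2) * d)\<^sup>2"
    unfolding D_def by (simp add: algebra_simps)
  have "2 * r\<^sup>2 + (9 - 15 * c\<^sup>2) * d \<noteq> 0" using D6 unfolding D_def by (simp add: algebra_simps)
  then have "c\<^sup>2 * (2 * r\<^sup>2 + (9 - 15 * c\<^sup>2) * d)\<^sup>2 \<noteq> 0" using cs by simp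
  then have "2 * r^7 * s\<^sup>2 * (2 * r\<^sup>2 + (3 - 9 * c\<^sup>2) * d) \<noteq> 0" using E5 by (metis mult_zero_right)
  then show "l\<^sup>2 = c\<^sup>2 * (2 * r\<^sup>2 + (9 - 15 * c\<^sup>2) * d)\<^sup>2 /
              (2 * r^7 * s\<^sup>2 * (2 * r\<^sup>2 + (3 - 9 * c\<^sup>2) * d))"
    using E5 by (simp add: eq_divide_eq)
qed

section \<open>The augmented potential along curves\<close>

lemma inner_inertia: "v \<bullet> (inertia I1 I2 *v v) = I2 * (norm v)\<^sup>2 + (I1 - I2) * (v$1)\<^sup>2"
  unfolding power2_norm_eq_inner
  by (simp add: inertia_def matrix_vector_mult_def inner_vec_def sum_3
      algebra_simps power2_eq_square)

lemma norm_transpose_rotation: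
  fixes B :: "real^3^3"
  assumes "rotation_matrix B"
  shows "norm (transpose B *v v) = norm v"
  using assms orthogonal_transformation_matrix[of "(*v) (transpose B)"]
  by (simp add: rotation_matrix_def orthogonal_transformation_norm del: transpose_matrix_vector)

text \<open>The spin cancels in the translational velocity, which becomes
  \<open>w \<times> R\<close>, and Lagrange's identity expands its norm. Writing
  \<open>norm \<xi>\<close> for the norm of \<open>w\<close> leaves the first component of
  \<open>w\<close> and its inner product with R as the only terms that vary with B.\<close>

lemma V_aug_rotation:
  assumes "rotation_matrix B"
  shows "V_aug I1 I2 (\<xi>, \<eta>) (B, R) = V2 I1 I2 R
    - 1/2 * (I2 * ((norm \<xi>)\<^sup>2 - 2 * \<eta> * (transpose B *v \<xi>)$1 + \<eta>\<^sup>2)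
        + (I1 - I2) * ((transpose B *v \<xi>)$1 - \<eta>)\<^sup>2
        + (norm \<xi>)\<^sup>2 * (R \<bullet> R) - ((transpose B *v \<xi>) \<bullet> R)\<^sup>2)"
proof -
  define w where "w = transpose B *v \<xi>"
  have n: "norm \<xi> = norm w" using norm_transpose_rotation[OF assms] by (simp add: w_def)
  have 1: "\<eta> *\<^sub>R (e1 \<times> R) + (w - \<eta> *\<^sub>R e1) \<times> R = w \<times> R"
    by (simp add: cross3_simps)
  have 2: "(norm (w \<times> R))\<^sup>2 = (norm w)\<^sup>2 * (R \<bullet> R) - (w \<bullet> R)\<^sup>2"
    using norm_cross_dot [of w R] by (simp add: power2_norm_eq_inner power_mult_distrib)
  have 3: "(norm (w - \<eta> *\<^sub>R e1))\<^sup>2 = (norm w)\<^sup>2 - 2 * \<eta> * w$1 + \<eta>\<^sup>2"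
    unfolding power2_norm_eq_inner
    by (simp add: inner_diff inner_axis inner_axis' power2_eq_square algebra_simps)
  show ?thesis
    unfolding V_aug_def kinetic_def inf_gen_def n
    by (simp add: w_def[symmetric] 1 2 3 inner_inertia del: transpose_matrix_vector)
qed

text \<open>The trace condition turns \<open>I2\<close> into \<open>(1 - d) / 3\<close>, so the
  potential becomes \<open>- 1 / n - d / (2 * n^3) + 3 * d * (R$1)\<^sup>2 / (2 * n^5)\<close>. Its
  gradient is therefore a combination of R and \<open>e1\<close>.\<close>

lemma V2_has_derivative_along:
  assumes R: "(R has_vector_derivative R') (at t)" and "R t \<noteq> 0" and tr: "I1 + 2 * I2 = 1"
  defines "n \<equiv> norm (R t)" and "d \<equiv> I1 - I2"
  shows "((\<lambda>t. V2 I1 I2 (R t)) has_real_derivative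
     (1 / n^3 + (3 / (2 * n^5) - 15 * (R t $ 1)\<^sup>2 / (2 * n^7)) * d) * (R t \<bullet> R')
     + 3 * d * R t $ 1 / n^5 * R' $ 1) (at t)"
proof -
  have n: "n > 0" using assms by (simp add: n_def)
  have dn: "((\<lambda>t. norm (R t)) has_real_derivative (R t \<bullet> R') / n) (at t)"
  proof -
    have "((\<lambda>t. norm (R t)) has_derivative (\<lambda>h. (h *\<^sub>R R') \<bullet> sgn (R t))) (at t)"
      using has_derivative_compose[OF R[unfolded has_vector_derivative_def]
          has_derivative_norm[OF \<open>R t \<noteq> 0\<close>]] .
    then show ?thesis
      by (rule has_derivative_imp_has_field_derivative)
        (simp add: sgn_div_norm n_def inner_commute divide_inverse)
  qed
  have d1: "((\<lambda>t. R t $ 1) has_real_derivative R' $ 1) (at t)"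
    using bounded_linear.has_vector_derivative[OF bounded_linear_vec_nth R]
    by (simp add: has_real_derivative_iff_has_vector_derivative)
  have I2: "I2 = (1 - d) / 3" using tr by (simp add: d_def)
  have [simp]: "norm (R t) = n" by (simp add: n_def)
  show ?thesis
    unfolding V2_def inner_inertia d_def[symmetric]
    apply (rule derivative_eq_intros dn d1 refl | (simp add: n less_imp_neq[OF n,symmetric]; fail))+
    using n by (simp add: I2 field_simps; simp add: eval_nat_numeral algebra_simps)
qed


lemma bounded_linear_transpose_mult: "bounded_linear (\<lambda>B. transpose B *v (\<xi> :: real^3))"
  by (intro linear_conv_bounded_linear[THEN iffD1] linearI)
    (simp_all add: vec_eq_iff matrix_vector_mult_def transpose_def sum.distrib
      sum_distrib_left algebra_simps del: transpose_matrix_vector)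

text \<open>Differentiate the constant squared norm of \<open>transpose (B t) *v v\<close>:
  velocities of rotations at the identity are skew.\<close>

lemma rotation_curve_derivative_skew:
  fixes v :: "real^3"
  assumes "(B has_vector_derivative B') (at 0)" "\<And>t. rotation_matrix (B t)" "B 0 = mat 1"
  shows "(transpose B' *v v) \<bullet> v = 0"
proof -
  have d: "((\<lambda>t. transpose (B t) *v v) has_vector_derivative transpose B' *v v) (at 0)"
    using bounded_linear.has_vector_derivative[OF bounded_linear_transpose_mult assms(1)] .
  have "((\<lambda>t. (transpose (B t) *v v) \<bullet> (transpose (B t) *v v)) has_vector_derivative
      v \<bullet> (transpose B' *v v) + (transpose B' *v v) \<bullet> v) (at 0)"
    using bounded_bilinear.has_vector_derivative[OF bounded_bilinear_inner d d] assms(3)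
    by (simp del: transpose_matrix_vector)
  moreover have "((\<lambda>t. (transpose (B t) *v v) \<bullet> (transpose (B t) *v v)) has_vector_derivative 0) (at 0)"
    using norm_transpose_rotation[OF assms(2)]
    by (simp add: power2_norm_eq_inner[symmetric] del: transpose_matrix_vector)
  ultimately have "v \<bullet> (transpose B' *v v) + (transpose B' *v v) \<bullet> v = 0"
    by (rule vector_derivative_unique_at)
  then show ?thesis by (simp add: inner_commute del: transpose_matrix_vector)
qed

text \<open>Arbitrary curves are allowed because both directions use this: special curves yield
  necessary conditions, while proving criticality requires all curves. The term
  \<open>I1 * \<eta>\<close> arises from \<open>d + I2 = I1\<close>.\<close>

lemma V_aug_has_derivative_along:
  fixes \<xi> :: "real^3"
  assumes B: "(B has_vector_derivative B') (at t)" and R: "(R has_vector_derivative R') (at t)"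
    and rot: "\<And>t. rotation_matrix (B t)" and "R t \<noteq> 0" and tr: "I1 + 2 * I2 = 1"
  defines "n \<equiv> norm (R t)" and "d \<equiv> I1 - I2"
    and "w \<equiv> transpose (B t) *v \<xi>" and "w' \<equiv> transpose B' *v \<xi>"
  shows "((\<lambda>t. V_aug I1 I2 (\<xi>, \<eta>) (B t, R t)) has_real_derivative
     (1 / n^3 + (3 / (2 * n^5) - 15 * (R t $ 1)\<^sup>2 / (2 * n^7)) * d) * (R t \<bullet> R')
     + 3 * d * R t $ 1 / n^5 * R' $ 1
     - w' $ 1 * (d * w $ 1 - I1 * \<eta>) - (norm \<xi>)\<^sup>2 * (R t \<bullet> R')
     + (w \<bullet> R t) * (w' \<bullet> R t + w \<bullet> R')) (at t)"
proof -
  from bounded_linear.has_vector_derivative[OF bounded_linear_transpose_mult B]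
  have dw: "((\<lambda>t. transpose (B t) *v \<xi>) has_vector_derivative w') (at t)"
    by (simp only: w'_def)
  have dw1: "((\<lambda>t. (transpose (B t) *v \<xi>) $ 1) has_real_derivative w' $ 1) (at t)"
    using bounded_linear.has_vector_derivative[OF bounded_linear_vec_nth dw]
    by (simp only: has_real_derivative_iff_has_vector_derivative)
  have dRR: "((\<lambda>t. R t \<bullet> R t) has_real_derivative R t \<bullet> R' + R' \<bullet> R t) (at t)"
    using bounded_bilinear.has_vector_derivative[OF bounded_bilinear_inner R R]
    by (simp only: has_real_derivative_iff_has_vector_derivative)
  have dwR: "((\<lambda>t. (transpose (B t) *v \<xi>) \<bullet> R t) has_real_derivative w \<bullet> R' + w' \<bullet> R t) (at t)"
    using bounded_bilinear.has_vector_derivative[OF bounded_bilinear_inner dw R]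
    by (simp only: has_real_derivative_iff_has_vector_derivative w_def)
  note dV = V2_has_derivative_along[OF R \<open>R t \<noteq> 0\<close> tr, folded n_def d_def]
  show ?thesis
    unfolding V_aug_rotation[OF rot]
    apply (rule derivative_eq_intros dV dw1 dRR dwR refl)+
    by (simp add: w_def[symmetric] d_def inner_commute[of R'] algebra_simps
        del: transpose_matrix_vector)
qed

section \<open>Necessary conditions\<close>

text \<open>R is varied along a straight line. This is admissible even if the line meets the origin,
  since \<open>Q_space\<close> constrains only B.\<close>

lemma rel_equilibrium_first_variation:
  assumes "rel_equilibrium I1 I2 ((mat 1, R), (\<xi>, \<eta>))"
    and "\<And>t. rotation_matrix (B t)" "B 0 = mat 1" "(B has_vector_derivative B') (at 0)"
    and tr: "I1 + 2 * I2 = 1"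
  defines "n \<equiv> norm R" and "d \<equiv> I1 - I2" and "w' \<equiv> transpose B' *v \<xi>"
  shows "(1 / n^3 + (3 / (2 * n^5) - 15 * (R $ 1)\<^sup>2 / (2 * n^7)) * d) * (R \<bullet> R')
     + 3 * d * R $ 1 / n^5 * R' $ 1
     - w' $ 1 * (d * \<xi> $ 1 - I1 * \<eta>) - (norm \<xi>)\<^sup>2 * (R \<bullet> R')
     + (\<xi> \<bullet> R) * (w' \<bullet> R + \<xi> \<bullet> R') = 0"
proof -
  define c where "c t = (B t, R + t *\<^sub>R R')" for t :: real
  have R0: "R \<noteq> 0" using assms(1) by (simp add: rel_equilibrium_def)
  have dR: "((\<lambda>t. R + t *\<^sub>R R') has_vector_derivative R') (at 0)"
    by (auto intro!: derivative_eq_intros)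
  have dc: "(c has_vector_derivative (B', R')) (at 0)"
    unfolding c_def using assms(4) dR by (rule has_vector_derivative_Pair)
  have "((\<lambda>t. V_aug I1 I2 (\<xi>, \<eta>) (c t)) has_real_derivative 0) (at 0)"
    using assms(1-3) differentiableI_vector[OF dc]
    unfolding rel_equilibrium_def critical_point_on_def Q_space_def
    by (elim conjE allE[of _ c]) (simp add: c_def)
  from DERIV_unique[OF this[unfolded c_def] V_aug_has_derivative_along[OF assms(4) dR assms(2) _ tr]]
  show ?thesis using R0 assms(3) by (simp add: n_def d_def w'_def del: transpose_matrix_vector)
qed

definition rot3 :: "real \<Rightarrow> real^3^3" where
  "rot3 t = vector [vector [cos t, - sin t, 0], vector [sin t, cos t, 0], vector [0, 0, 1]]"

text \<open>By the right-hand rule the angle is -t; this sign makes the momentum equation that of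
  \<open>rot3\<close> with index 3 in place of 2.\<close>

definition rot2 :: "real \<Rightarrow> real^3^3" where
  "rot2 t = vector [vector [cos t, 0, - sin t], vector [0, 1, 0], vector [sin t, 0, cos t]]"

lemma rotation_rot2: "rotation_matrix (rot2 t)" and rotation_rot3: "rotation_matrix (rot3 t)"
  using sin_cos_squared_add[of t]
  by (simp_all add: rotation_matrix_def orthogonal_matrix vec_eq_iff forall_3 rot2_def rot3_def
      matrix_matrix_mult_def transpose_def sum_3 mat_def det_3 power2_eq_square add.commute)

lemma rot2_0: "rot2 0 = mat 1" and rot3_0: "rot3 0 = mat 1"
  by (simp_all add: rot2_def rot3_def vec_eq_iff forall_3 mat_def)

lemma rot3_has_vector_derivative: "(rot3 has_vector_derivative
   vector [vector [0, -1, 0], vector [1, 0, 0], vector [0, 0, 0]]) (at 0)"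
  (is "(_ has_vector_derivative ?J) _")
proof -
  \<comment> \<open>\<open>axis 3 (axis 3 1)\<close> is the matrix unit at (3, 3), and
    \<open>rot3 0\<close> minus it projects onto the rotated plane. The coefficient
    \<open>cos t\<close> of that projection has derivative 0 at 0.\<close>
  have "rot3 = (\<lambda>t. sin t *\<^sub>R ?J + (cos t *\<^sub>R (rot3 0 - axis 3 (axis 3 1)) + axis 3 (axis 3 1)))"
    by (rule ext) (simp add: rot3_def vec_eq_iff forall_3 axis_def)
  then show ?thesis
    by (elim ssubst) (auto intro!: derivative_eq_intros)
qed

lemma rot2_has_vector_derivative: "(rot2 has_vector_derivative
   vector [vector [0, 0, -1], vector [0, 0, 0], vector [1, 0, 0]]) (at 0)"
  (is "(_ has_vector_derivative ?J) _")
proof -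
  have "rot2 = (\<lambda>t. sin t *\<^sub>R ?J + (cos t *\<^sub>R (rot2 0 - axis 2 (axis 2 1)) + axis 2 (axis 2 1)))"
    by (rule ext) (simp add: rot2_def vec_eq_iff forall_3 axis_def)
  then show ?thesis
    by (elim ssubst) (auto intro!: derivative_eq_intros)
qed


lemma rel_equilibrium_equations:
  assumes re: "rel_equilibrium I1 I2 ((mat 1, R), (\<xi>, \<eta>))"
    and tr: "I1 + 2 * I2 = 1"
  defines "n \<equiv> norm R" and "d \<equiv> I1 - I2"
  defines "a \<equiv> 1 / n^3 + (3 / (2 * n^5) - 15 * (R $ 1)\<^sup>2 / (2 * n^7)) * d"
  shows "(R \<bullet> \<xi>) * \<xi>$1 = ((norm \<xi>)\<^sup>2 - a) * R$1 - 3 * d * R$1 / n^5"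
    and "(R \<bullet> \<xi>) * \<xi>$2 = ((norm \<xi>)\<^sup>2 - a) * R$2"
    and "(R \<bullet> \<xi>) * \<xi>$3 = ((norm \<xi>)\<^sup>2 - a) * R$3"
    and "\<xi>$2 * (d * \<xi>$1 - I1 * \<eta>) = (R \<bullet> \<xi>) * (\<xi>$2 * R$1 - \<xi>$1 * R$2)"
    and "\<xi>$3 * (d * \<xi>$1 - I1 * \<eta>) = (R \<bullet> \<xi>) * (\<xi>$3 * R$1 - \<xi>$1 * R$3)"
proof -
  have rot1: "rotation_matrix (mat 1 :: real^3^3)"
    by (simp add: rotation_matrix_def orthogonal_matrix_id)
  note E = rel_equilibrium_first_variation[OF re _ _ _ tr, folded n_def d_def, folded a_def]
  have ax: "axis 2 (1::real) $ (1::3) = 0" "axis 3 (1::real) $ (1::3) = 0"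
    by (simp_all add: axis_def)
  have grad: "a * (R \<bullet> v) + 3 * d * R$1 / n^5 * v$1 - (norm \<xi>)\<^sup>2 * (R \<bullet> v)
      + (\<xi> \<bullet> R) * (\<xi> \<bullet> v) = 0" for v
    using E[of "\<lambda>_. mat 1" 0 v] rot1
    by (simp add: transpose_def matrix_vector_mult_def zero_vec_def[symmetric])
  show "(R \<bullet> \<xi>) * \<xi>$1 = ((norm \<xi>)\<^sup>2 - a) * R$1 - 3 * d * R$1 / n^5"
    using grad[of "axis 1 1"] by (simp add: inner_axis inner_commute[of \<xi>] algebra_simps)
  show "(R \<bullet> \<xi>) * \<xi>$2 = ((norm \<xi>)\<^sup>2 - a) * R$2"
    using grad[of "axis 2 1"] by (simp add: inner_axis ax inner_commute[of \<xi>] algebra_simps)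
  show "(R \<bullet> \<xi>) * \<xi>$3 = ((norm \<xi>)\<^sup>2 - a) * R$3"
    using grad[of "axis 3 1"] by (simp add: inner_axis ax inner_commute[of \<xi>] algebra_simps)
  \<comment> \<open>With R fixed, \<open>rot3\<close> gives (\<xi>$2, -\<xi>$1, 0) for
    \<open>w'\<close>; below, \<open>rot2\<close> gives (\<xi>$3, 0, -\<xi>$1).\<close>
  show "\<xi>$2 * (d * \<xi>$1 - I1 * \<eta>) = (R \<bullet> \<xi>) * (\<xi>$2 * R$1 - \<xi>$1 * R$2)"
    using E[OF rotation_rot3 rot3_0 rot3_has_vector_derivative, of 0]
    by (simp add: matrix_vector_mult_def transpose_def sum_3 inner_vec_def algebra_simps
        del: transpose_matrix_vector)
  show "\<xi>$3 * (d * \<xi>$1 - I1 * \<eta>) = (R \<bullet> \<xi>) * (\<xi>$3 * R$1 - \<xi>$1 * R$3)"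
    using E[OF rotation_rot2 rot2_0 rot2_has_vector_derivative, of 0]
    by (simp add: matrix_vector_mult_def transpose_def sum_3 inner_vec_def algebra_simps
        del: transpose_matrix_vector)
qed

section \<open>The parallel family\<close>

text \<open>By \<open>grad\<close>, R is a critical point of \<open>V2\<close>. For a velocity
  parallel to R the two terms quadratic in \<open>k\<close> that contain \<open>r'\<close> cancel,
  and skewness leaves only \<open>- k\<^sup>2 * d * (z$1 * R$1)\<close>. This vanishes on the
  equator because \<open>R$1 = 0\<close>, and on the axis because \<open>z\<close> is orthogonal to
  R.\<close>

lemma rel_equilibrium_parallel:
  assumes R: "R \<noteq> 0" and tr: "I1 + 2 * I2 = 1"
    and ax: "R$1 = 0 \<or> R = R$1 *\<^sub>R e1"
  defines "n \<equiv> norm R" and "d \<equiv> I1 - I2"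
  defines "a \<equiv> 1 / n^3 + (3 / (2 * n^5) - 15 * (R $ 1)\<^sup>2 / (2 * n^7)) * d"
  assumes grad: "\<And>v. a * (R \<bullet> v) + 3 * d * R$1 / n^5 * v$1 = 0"
  shows "rel_equilibrium I1 I2 ((mat 1, R), (k *\<^sub>R R, 0))"
  unfolding rel_equilibrium_def critical_point_on_def
proof (intro conjI allI impI; (elim conjE)?)
  show "snd (fst ((mat 1 :: real^3^3, R), (k *\<^sub>R R, 0::real))) \<noteq> 0" using R by simp
  show "fst ((mat 1, R), (k *\<^sub>R R, 0::real)) \<in> Q_space"
    by (simp add: Q_space_def rotation_matrix_def orthogonal_matrix_id)
  fix c :: "real \<Rightarrow> config"
  assume c: "\<forall>t. c t \<in> Q_space" "c 0 = fst ((mat 1, R), (k *\<^sub>R R, 0::real))" "c differentiable at 0"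
  define B where "B t = fst (c t)" for t
  define r where "r t = snd (c t)" for t
  obtain D where D: "(c has_vector_derivative D) (at 0)"
    using c(3) vector_derivative_works by blast
  define B' where "B' = fst D"
  define r' where "r' = snd D"
  have dB: "(B has_vector_derivative B') (at 0)"
    unfolding B_def B'_def by (rule bounded_linear.has_vector_derivative[OF bounded_linear_fst D])
  have dr: "(r has_vector_derivative r') (at 0)"
    unfolding r_def r'_def by (rule bounded_linear.has_vector_derivative[OF bounded_linear_snd D])
  have rot: "rotation_matrix (B t)" for t using c(1) by (simp add: Q_space_def B_def split_beta)
  have 0: "B 0 = mat 1" "r 0 = R" using c(2) by (simp_all add: B_def r_def)
  define z where "z = transpose B' *v R"
  have z: "z \<bullet> R = 0" using rotation_curve_derivative_skew[OF dB rot 0(1)] by (simp only: z_def)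
  have z1: "z$1 * R$1 = 0"
    using ax
  proof
    assume "R = R$1 *\<^sub>R e1"
    then have "R$2 = 0" "R$3 = 0"
      by (simp_all add: vec_eq_iff forall_3 axis_def)
    then show ?thesis using z by (simp add: inner_vec_def sum_3)
  qed simp
  have kz: "transpose B' *v (k *\<^sub>R R) = k *\<^sub>R z"
    by (simp add: z_def matrix_vector_mult_scaleR del: transpose_matrix_vector)
  have "((\<lambda>t. V_aug I1 I2 (k *\<^sub>R R, 0) (B t, r t)) has_real_derivative
     a * (R \<bullet> r') + 3 * d * R$1 / n^5 * r'$1
     - (k *\<^sub>R z) $ 1 * (d * (k *\<^sub>R R) $ 1 - I1 * 0) - (norm (k *\<^sub>R R))\<^sup>2 * (R \<bullet> r')
     + (k *\<^sub>R R \<bullet> R) * (k *\<^sub>R z \<bullet> R + k *\<^sub>R R \<bullet> r')) (at 0)"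
    using V_aug_has_derivative_along[OF dB dr rot _ tr, of "k *\<^sub>R R" 0] R
    by (simp only: 0 kz n_def d_def a_def transpose_mat matrix_vector_mul_lid not_False_eq_True)
  also have "a * (R \<bullet> r') + 3 * d * R$1 / n^5 * r'$1
     - (k *\<^sub>R z) $ 1 * (d * (k *\<^sub>R R) $ 1 - I1 * 0) - (norm (k *\<^sub>R R))\<^sup>2 * (R \<bullet> r')
     + (k *\<^sub>R R \<bullet> R) * (k *\<^sub>R z \<bullet> R + k *\<^sub>R R \<bullet> r') = - k\<^sup>2 * d * (z$1 * R$1)"
    unfolding grad power2_norm_eq_inner using z by (simp add: power2_eq_square)
  finally show "((\<lambda>t. V_aug I1 I2 (snd ((mat 1, R), (k *\<^sub>R R, 0))) (c t)) has_real_derivative 0) (at 0)"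
    by (simp add: z1 B_def r_def)
qed


text \<open>The trace condition gives \<open>1 - 3 * I2 = I1 - I2\<close>, so the hypothesis
  \<open>n\<close> expresses both the vanishing of the gradient of \<open>V2\<close> and the radius
  equation in \<open>parallel\<close>.\<close>

lemma parallel_equatorial:
  assumes R: "R \<noteq> 0" "R$1 = 0" and tr: "I1 + 2 * I2 = 1"
    and n: "2 * (norm R)\<^sup>2 + 3 * (I1 - I2) = 0"
  shows "parallel I1 I2 R (k *\<^sub>R R) 0"
proof -
  have IR: "inertia I1 I2 *v R = I2 *\<^sub>R R"
    using R by (simp add: inertia_def matrix_vector_mult_def vec_eq_iff forall_3 sum_3)
  have d: "I1 - I2 = - 2 * (norm R)\<^sup>2 / 3" using n by simp
  have "rel_equilibrium I1 I2 ((mat 1, R), (c *\<^sub>R R, 0))" for c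
    using R by (intro rel_equilibrium_parallel tr) (simp_all add: d field_simps eval_nat_numeral)
  moreover have "1 + 3 / (2 * (norm R)\<^sup>2) * (1 - 3 * (R \<bullet> (inertia I1 I2 *v R) / (norm R)\<^sup>2)) = 0"
  proof -
    have "R \<bullet> (inertia I1 I2 *v R) / (norm R)\<^sup>2 = I2"
      using R by (simp add: IR power2_norm_eq_inner)
    moreover have "1 - 3 * I2 = - 2 * (norm R)\<^sup>2 / 3" using tr n by argo
    ultimately show ?thesis using R by simp
  qed
  ultimately show ?thesis
    unfolding parallel_def using R IR by blast
qed

text \<open>On the axis the \<open>e1\<close> term of the gradient is a multiple of R and adds to
  the radial coefficient. As \<open>1 - 3 * I1 = - 2 * (I1 - I2)\<close>, the hypothesis
  \<open>n\<close> again expresses both conditions.\<close>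

lemma parallel_axial:
  assumes R: "R \<noteq> 0" "R = R$1 *\<^sub>R e1" and tr: "I1 + 2 * I2 = 1"
    and n: "(norm R)\<^sup>2 = 3 * (I1 - I2)"
  shows "parallel I1 I2 R (k *\<^sub>R R) 0"
proof -
  have R0: "R$2 = 0" "R$3 = 0"
    using R(2) by (simp_all add: vec_eq_iff forall_3 axis_def)
  have IR: "inertia I1 I2 *v R = I1 *\<^sub>R R"
    using R0 by (simp add: inertia_def matrix_vector_mult_def vec_eq_iff forall_3 sum_3)
  have d: "I1 - I2 = (norm R)\<^sup>2 / 3" using n by simp
  have R1: "(R$1)\<^sup>2 = (norm R)\<^sup>2"
    unfolding power2_norm_eq_inner using R0 by (simp add: inner_vec_def sum_3 power2_eq_square)
  have "rel_equilibrium I1 I2 ((mat 1, R), (c *\<^sub>R R, 0))" for c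
  proof (intro rel_equilibrium_parallel R tr disjI2)
    fix v
    have "R \<bullet> v = R$1 * v$1" using R0 by (simp add: inner_vec_def sum_3)
    then show "(1 / norm R ^ 3 + (3 / (2 * norm R ^ 5) - 15 * (R$1)\<^sup>2 / (2 * norm R ^ 7)) * (I1 - I2)) * (R \<bullet> v)
      + 3 * (I1 - I2) * R$1 / norm R ^ 5 * v$1 = 0"
      using R(1) unfolding d R1 by (simp add: field_simps eval_nat_numeral)
  qed
  moreover have "1 + 3 / (2 * (norm R)\<^sup>2) * (1 - 3 * (R \<bullet> (inertia I1 I2 *v R) / (norm R)\<^sup>2)) = 0"
  proof -
    have "R \<bullet> (inertia I1 I2 *v R) / (norm R)\<^sup>2 = I1"
      using R(1) by (simp add: IR power2_norm_eq_inner)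
    moreover have "1 - 3 * I1 = - 2 * (norm R)\<^sup>2 / 3" using tr n by argo
    ultimately show ?thesis using R by simp
  qed
  ultimately show ?thesis
    unfolding parallel_def using R(1) IR by blast
qed

section \<open>Normalisation by axial rotations and classification\<close>

text \<open>Using the same rotation in both factors keeps the attitude at the identity, and
  \<open>chi N = 1\<close> preserves the spin.\<close>

lemma axial_rotation:
  assumes "u\<^sup>2 + v\<^sup>2 = (1::real)"
  defines "N \<equiv> diag_block 1 (vector [vector [u, v], vector [-v, u]])"
  shows "(N, N) \<in> G_axi"
    and "translate (N, N) ((mat 1, R), (\<xi>, \<eta>)) = ((mat 1, N *v R), (N *v \<xi>, \<eta>))"
    and "N *v R = vector [R$1, u * R$2 + v * R$3, u * R$3 - v * R$2]"
proof -
  have N: "orthogonal_matrix N" "det N = 1" "chi N = 1"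
    using assms(1)
    by (simp_all add: N_def diag_block_def orthogonal_matrix matrix_matrix_mult_def transpose_def
        vec_eq_iff forall_3 sum_3 mat_def det_3 det_2 chi_def lower_block_def power2_eq_square add.commute)
  have "orthogonal_matrix (vector [vector [u, v], vector [-v, u]] :: real^2^2)"
    using assms(1)
    by (simp add: orthogonal_matrix matrix_matrix_mult_def transpose_def
        vec_eq_iff forall_2 sum_2 mat_def power2_eq_square add.commute)
  then show "(N, N) \<in> G_axi"
    using N unfolding G_axi_def Gamma_axi_def rotation_matrix_def N_def by blast
  show "translate (N, N) ((mat 1, R), (\<xi>, \<eta>)) = ((mat 1, N *v R), (N *v \<xi>, \<eta>))"
    using N by (simp add: translate_def act_def Ad_def orthogonal_matrix_def)
  show "N *v R = vector [R$1, u * R$2 + v * R$3, u * R$3 - v * R$2]"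
    by (simp add: N_def diag_block_def matrix_vector_mult_def vec_eq_iff forall_3 sum_3)
qed

theorem proposition4p3:
  fixes I1 I2 \<eta> :: real and R \<xi> :: "real^3"
  assumes "I1 \<noteq> I2"
    and "0 < I1" "I1 < 1/2" "0 < I2" "I2 < 1/2"
    and "I1 + 2 * I2 = 1"
    and "rel_equilibrium I1 I2 ((mat 1, R), (\<xi>, \<eta>))"
    and "R \<bullet> \<xi> \<noteq> 0"
  shows "\<exists>g \<in> G_axi. \<exists>R' \<xi>' \<eta>'.
     translate g ((mat 1, R), (\<xi>, \<eta>)) = ((mat 1, R'), (\<xi>', \<eta>')) \<and>
     (conical I1 I2 R' \<xi>' \<eta>' \<or>
      (\<exists>\<xi>0 \<eta>0. same_state ((mat 1, R'), (\<xi>', \<eta>')) ((mat 1, R'), (\<xi>0, \<eta>0)) \<and>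
        (R' \<notin> span {e1} \<longrightarrow> \<xi>0 = \<xi>' \<and> \<eta>0 = \<eta>') \<and>
        parallel I1 I2 R' \<xi>0 \<eta>0))"
proof -
  define n where "n = norm R"
  define d where "d = I1 - I2"
  define p where "p = R \<bullet> \<xi>"
  define a where "a = 1 / n^3 + (3 / (2 * n^5) - 15 * (R $ 1)\<^sup>2 / (2 * n^7)) * d"
  \<comment> \<open>Gradient components 2 and 3 show that this is the common ratio of the velocity
    to R in the plane orthogonal to the axis.\<close>
  define l where "l = ((norm \<xi>)\<^sup>2 - a) / p"
  define \<rho> where "\<rho> = sqrt ((R$2)\<^sup>2 + (R$3)\<^sup>2)"
  have p: "p \<noteq> 0" using assms(8) by (simp add: p_def)
  have R: "R \<noteq> 0" using assms(8) by auto
  then have n: "n > 0" by (simp add: n_def)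
  have d: "d \<noteq> 0" using assms(1) by (simp add: d_def)
  note E = rel_equilibrium_equations[OF assms(7,6), folded n_def d_def p_def, folded a_def]
  have lp: "(norm \<xi>)\<^sup>2 - a = l * p" using p by (simp add: l_def)
  have \<xi>23: "\<xi>$2 = l * R$2" "\<xi>$3 = l * R$3"
    using E(2,3) p unfolding lp by simp_all
  have \<rho>2: "\<rho>\<^sup>2 = (R$2)\<^sup>2 + (R$3)\<^sup>2" by (simp add: \<rho>_def)
  have n2: "n\<^sup>2 = (R$1)\<^sup>2 + \<rho>\<^sup>2"
    unfolding n_def power2_norm_eq_inner \<rho>2 by (simp add: inner_vec_def sum_3 power2_eq_square)
  have \<xi>n: "(norm \<xi>)\<^sup>2 = (\<xi>$1)\<^sup>2 + l\<^sup>2 * \<rho>\<^sup>2"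
    unfolding power2_norm_eq_inner \<rho>2
    by (simp add: inner_vec_def sum_3 power2_eq_square \<xi>23 algebra_simps)
  have p_eq: "p = \<xi>$1 * R$1 + l * \<rho>\<^sup>2"
    unfolding p_def \<rho>2 by (simp add: inner_vec_def sum_3 power2_eq_square \<xi>23 algebra_simps)
  have par: ?thesis if "same_state ((mat 1, R), (\<xi>, \<eta>)) ((mat 1, R), (\<xi>0, \<eta>0))"
    "R \<notin> span {e1} \<longrightarrow> \<xi>0 = \<xi> \<and> \<eta>0 = \<eta>" "parallel I1 I2 R \<xi>0 \<eta>0" for \<xi>0 \<eta>0
  proof -
    \<comment> \<open>The parallel family needs no normalisation, so the identity is taken as
      translation.\<close>
    note r = axial_rotation[of 1 0, simplified]
    have "vector [x$1, x$2, x$3] = x" for x :: "real^3" by (simp add: vec_eq_iff forall_3)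
    then show ?thesis using that r by metis
  qed
  consider "R$1 = 0" | "R$1 \<noteq> 0" "\<rho> = 0" | "R$1 \<noteq> 0" "\<rho> \<noteq> 0" by blast
  then show ?thesis
  proof cases
    case 1
    have "\<xi>$1 = 0" using E(1) p 1 by simp
    then have \<xi>: "\<xi> = l *\<^sub>R R" using \<xi>23 1 by (simp add: vec_eq_iff forall_3)
    then have l: "l \<noteq> 0" using assms(8) by auto
    have "R$2 \<noteq> 0 \<or> R$3 \<noteq> 0" using R 1 by (auto simp: vec_eq_iff forall_3)
    then have "\<eta> = 0" using E(4,5) 1 \<open>\<xi>$1 = 0\<close> l \<xi>23 assms(2) by auto
    \<comment> \<open>On the equator
      \<open>(norm \<xi>)\<^sup>2 = l\<^sup>2 * \<rho>\<^sup>2 = l * p\<close>.\<close>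
    have "a = 0" using lp \<xi>n p_eq 1 by (simp add: power2_eq_square \<open>\<xi>$1 = 0\<close>)
    then have "2 * n\<^sup>2 + 3 * d = 0" using n 1 by (simp add: a_def field_simps eval_nat_numeral)
    then have "parallel I1 I2 R \<xi> \<eta>"
      unfolding \<xi> \<open>\<eta> = 0\<close>
      by (intro parallel_equatorial R 1 assms) (simp add: n_def d_def)
    then show ?thesis by (intro par[of \<xi> \<eta>]) (simp_all add: same_state_def)
  next
    case 2
    then have R0: "R$2 = 0" "R$3 = 0" by (simp_all add: \<rho>_def)
    have Re: "R = R$1 *\<^sub>R e1" using R0 by (simp add: vec_eq_iff forall_3 axis_def)
    have R1: "(R$1)\<^sup>2 = n\<^sup>2" using n2 2 by simp
    \<comment> \<open>Here \<open>p = \<xi>$1 * R$1\<close>, so the velocity cancels and a condition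
      on R alone remains.\<close>
    have "(a + 3 * d / n^5) * R$1 = 0"
      using E(1) unfolding \<xi>n p_eq 2 by (simp add: algebra_simps power2_eq_square)
    then have "a + 3 * d / n^5 = 0" using 2 by simp
    then have "n\<^sup>2 = 3 * d" using n unfolding a_def R1 by (simp add: field_simps eval_nat_numeral)
    \<comment> \<open>The factor is chosen so that the multiple of R equals
      \<open>\<xi> - \<eta> *\<^sub>R e1\<close>, which generates the same tangent vector with zero
      spin.\<close>
    then have "parallel I1 I2 R (((\<xi>$1 - \<eta>) / R$1) *\<^sub>R R) 0"
      by (intro parallel_axial R Re assms) (simp add: n_def d_def)
    moreover have "((\<xi>$1 - \<eta>) / R$1) *\<^sub>R R = \<xi> - \<eta> *\<^sub>R e1"
      using R0 \<xi>23 2 by (simp add: vec_eq_iff forall_3 axis_def)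
    ultimately have "parallel I1 I2 R (\<xi> - \<eta> *\<^sub>R e1) 0" by simp
    moreover have "R \<in> span {e1}" by (subst Re) (simp add: span_base span_scale)
    moreover have "e1 \<times> R = 0" by (subst Re) (simp add: cross_mult_right)
    ultimately show ?thesis by (intro par[of "\<xi> - \<eta> *\<^sub>R e1" 0]) (simp_all add: same_state_def inf_gen_def)
  next
    case 3
    have \<rho>: "\<rho> > 0" using 3 unfolding \<rho>_def by (simp add: sum_power2_gt_zero_iff)
    \<comment> \<open>The rotation below makes the second coordinate of R equal to
      \<open>\<rho> > 0\<close>, so the polar angle lies in the upper half circle, the range of
      \<open>arccos\<close>.\<close>
    define \<psi> where "\<psi> = arccos (R$1 / n)"
    have cn: "\<bar>R$1 / n\<bar> \<le> 1"
    proof -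
      have "(R$1)\<^sup>2 \<le> n\<^sup>2" using n2 by simp
      then have "\<bar>R$1\<bar> \<le> n" using n by (simp add: abs_le_square_iff[symmetric])
      then show ?thesis using n by (simp add: abs_divide)
    qed
    then have c: "cos \<psi> = R$1 / n" by (simp add: \<psi>_def cos_arccos_abs)
    have "1 - (R$1 / n)\<^sup>2 = (\<rho> / n)\<^sup>2"
    proof -
      have "(R$1)\<^sup>2 = n\<^sup>2 - \<rho>\<^sup>2" using n2 by simp
      then show ?thesis using n by (simp add: power_divide diff_divide_distrib)
    qed
    then have s: "sin \<psi> = \<rho> / n"
      using cn \<rho> n by (simp add: \<psi>_def sin_arccos_abs real_sqrt_divide)
    have \<psi>: "\<psi> \<in> {-pi<..pi} - {0, pi/2, -pi/2, pi}"
    proof -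
      have "0 \<le> \<psi>" "\<psi> \<le> pi"
        using cn unfolding \<psi>_def abs_le_iff minus_le_iff[of _ 1] by (auto intro: arccos_lbound arccos_ubound)
      moreover have "sin \<psi> \<noteq> 0" "cos \<psi> \<noteq> 0" using c s 3 n by auto
      moreover have "\<psi> \<noteq> 0" "\<psi> \<noteq> pi" "\<psi> \<noteq> pi / 2" using calculation(3,4) by (metis sin_zero sin_pi cos_pi_half)+
      moreover have "- pi < \<psi>" "\<psi> \<noteq> - pi / 2" using calculation(1) pi_gt_zero by linarith+
      ultimately show ?thesis
        unfolding Diff_iff greaterThanAtMost_iff insert_iff empty_iff by blast
    qed
    have R1: "R$1 = n * cos \<psi>" and \<rho>s: "\<rho> = n * sin \<psi>" using c s n by simp_all
    \<comment> \<open>Weighting the two momentum equations by \<open>R$2\<close> and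
      \<open>R$3\<close> gives one equation with the nonzero factor \<open>\<rho>\<^sup>2\<close>,
      without deciding which coordinate is nonzero.\<close>
    have "\<rho>\<^sup>2 * (l * (d * \<xi>$1 - I1 * \<eta>)) =
      R$2 * (\<xi>$2 * (d * \<xi>$1 - I1 * \<eta>)) + R$3 * (\<xi>$3 * (d * \<xi>$1 - I1 * \<eta>))"
      unfolding \<xi>23 \<rho>2 by (simp add: algebra_simps power2_eq_square)
    also have "\<dots> = \<rho>\<^sup>2 * (p * (l * R$1 - \<xi>$1))"
      unfolding E(4,5) unfolding \<xi>23 \<rho>2 by (simp add: algebra_simps power2_eq_square)
    finally have A: "l * (d * \<xi>$1 - I1 * \<eta>) = p * (l * R$1 - \<xi>$1)" using 3 by simp
    have a5: "a * (2 * n^5) = 2 * n\<^sup>2 + (3 - 15 * (cos \<psi>)\<^sup>2) * d"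
      unfolding a_def R1 using n by (simp add: field_simps eval_nat_numeral)
    have B1: "p * \<xi>$1 = ((\<xi>$1)\<^sup>2 + l\<^sup>2 * n\<^sup>2 * (sin \<psi>)\<^sup>2 - a) * (n * cos \<psi>) - 3 * d * cos \<psi> / n^4"
      using E(1) n unfolding \<xi>n unfolding R1 \<rho>s
      by (simp add: power_mult_distrib eval_nat_numeral mult.assoc)
    have B2: "p * l = (\<xi>$1)\<^sup>2 + l\<^sup>2 * n\<^sup>2 * (sin \<psi>)\<^sup>2 - a"
      using lp unfolding \<xi>n \<rho>s by (simp add: power_mult_distrib mult.commute[of p] mult.assoc)
    have p': "p = n * (\<xi>$1 * cos \<psi> + l * n * (sin \<psi>)\<^sup>2)"
      unfolding p_eq R1 \<rho>s by (simp add: algebra_simps power2_eq_square)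
    have sc: "(cos \<psi>)\<^sup>2 + (sin \<psi>)\<^sup>2 = 1" "cos \<psi> \<noteq> 0" "sin \<psi> \<noteq> 0"
      using 3 n by (auto simp: R1 \<rho>s)
    note F = conical_formulas[OF sc n d assms(2) p' p a5 B1 B2 A[unfolded R1]]
    \<comment> \<open>This rotation takes (R$2, R$3) to (\<rho>, 0), hence also the last two
      components of \<xi>, being \<open>l\<close> times these, to a multiple of (1, 0).\<close>
    define N where "N = diag_block 1 (vector [vector [R$2 / \<rho>, R$3 / \<rho>], vector [- (R$3 / \<rho>), R$2 / \<rho>]])"
    have uv: "(R$2 / \<rho>)\<^sup>2 + (R$3 / \<rho>)\<^sup>2 = 1"
      using 3 by (simp add: power_divide add_divide_distrib[symmetric] \<rho>2[symmetric])
    note r = axial_rotation[OF uv, folded N_def]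
    have "R$2 / \<rho> * R$2 + R$3 / \<rho> * R$3 = \<rho>"
      using \<rho>2 3 by (simp add: field_simps power2_eq_square)
    then have NR: "N *v R = n *\<^sub>R vector [cos \<psi>, sin \<psi>, 0]"
      unfolding r(3) by (simp add: vec_eq_iff forall_3 R1 \<rho>s[symmetric])
    have "R$2 / \<rho> * \<xi>$2 + R$3 / \<rho> * \<xi>$3 = l * (R$2 / \<rho> * R$2 + R$3 / \<rho> * R$3)"
      unfolding \<xi>23 by (simp add: algebra_simps)
    also have "\<dots> = l * n * sin \<psi>"
      using \<open>R$2 / \<rho> * R$2 + R$3 / \<rho> * R$3 = \<rho>\<close> \<rho>s by simp
    finally have N\<xi>: "N *v \<xi> = vector [\<xi>$1, l * n * sin \<psi>, 0]"
      unfolding r(3) using \<xi>23 by (simp add: vec_eq_iff forall_3)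
    have "conical I1 I2 (N *v R) (N *v \<xi>) \<eta>"
      unfolding conical_def using n \<psi> F NR N\<xi> unfolding d_def by blast
    then show ?thesis using r(1,2) by blast
  qed
qed

end
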